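(* Let $c=(c_1,\dots,c_N)\in\mathbb{R}^N$ be a constant vector and let $\nu>0$ be fixed. Consider the initial value problem $$(u_j)_t+\sigma(c,u)(u_j)_x=\frac{\nu}{2}(u_j)_{xx},\qquad u_j(x,0)=u_{0j}(x),\qquad j=1,2,\dots,N,$$ where $u=(u_1,\dots,u_N)$ and $\sigma(c,u)=\sum_{k=1}^N c_ku_k$. Put $I(x)=\int_0^x\sigma(c,u_0(z))\,dz$, where $u_0=(u_{01},\dots,u_{0N})$, and assume that the limits $\lim_{x\to\infty}I(x)=I(\infty)$, $\lim_{x\to-\infty}I(x)=I(-\infty)$, $\lim_{x\to\infty}u_{0j}(x)=u_{0j}(\infty)$ and $\lim_{x\to-\infty}u_{0j}(x)=u_{0j}(-\infty)$, $j=1,\dots,N$, exist and are finite. Then the solution $u^\nu(x,t)=(u_1^\nu(x,t),\dots,u_N^\nu(x,t))$ of this problem has the following asymptotic behaviour as $t$ tends to infinity: $$u_j^{\nu}(x,t)\approx \frac{u_{0j}(\infty)\,e^{-I(\infty)/\nu}\int_{-\infty}^{x/\sqrt{t\nu}}e^{-y^2/2}\,dy+u_{0j}(-\infty)\,e^{-I(-\infty)/\nu}\int_{x/\sqrt{t\nu}}^{\infty}e^{-y^2/2}\,dy}{e^{-I(\infty)/\nu}\int_{-\infty}^{x/\sqrt{t\nu}}e^{-y^2/2}\,dy+e^{-I(-\infty)/\nu}\int_{x/\sqrt{t\nu}}^{\infty}e^{-y^2/2}\,dy},\qquad j=1,\dots,N.$$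
   Context: The solution of the viscous system $(u_j)_t+\sigma(c,u)(u_j)_x=\frac{\nu}{2}(u_j)_{xx}$ with $u_j(x,0)=u_{0j}(x)$ is the one given, for $x\in\mathbb{R}$ and $t>0$, by the explicit formula obtained from a generalized Hopf--Cole transformation, $$u_j^\nu(x,t)=\frac{\int_{-\infty}^{\infty}u_{0j}(y)\,e^{-\frac1\nu\left[I(y)+\frac{(x-y)^2}{2t}\right]}\,dy}{\int_{-\infty}^{\infty}e^{-\frac1\nu\left[I(y)+\frac{(x-y)^2}{2t}\right]}\,dy},\qquad j=1,\dots,N,$$ where $I(y)=\int_0^y\sigma(c,u_0(z))\,dz$ and $\sigma(c,u_0(z))=\sum_{k=1}^N c_ku_{0k}(z)$. *)

theory Defs
  imports "HOL-Analysis.Analysis"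
begin

definition sigma :: "real ^ 'n \<Rightarrow> real ^ 'n \<Rightarrow> real" where
  "sigma c u = (\<Sum>k\<in>UNIV. c $ k * u $ k)"

text \<open>The integral is oriented: for \<open>x < 0\<close> it is minus the integral over \<open>{x<..<0}\<close>.\<close>

definition sigma_primitive :: "real ^ 'n \<Rightarrow> (real \<Rightarrow> real ^ 'n) \<Rightarrow> real \<Rightarrow> real" where
  "sigma_primitive c u0 x = (LINT z=0..ereal x|lebesgue. sigma c (u0 z))"

definition hopf_cole_weight ::
    "real \<Rightarrow> real ^ 'n \<Rightarrow> (real \<Rightarrow> real ^ 'n) \<Rightarrow> real \<Rightarrow> real \<Rightarrow> real \<Rightarrow> real" where
  "hopf_cole_weight \<nu> c u0 x t y =
     exp (- (1 / \<nu>) * (sigma_primitive c u0 y + (x - y)\<^sup>2 / (2 * t)))"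

text \<open>
  The solution, given by the generalized Hopf--Cole formula, of the initial value problem
  \<open>(u\<^sub>j)\<^sub>t + sigma c u * (u\<^sub>j)\<^sub>x = \<nu> / 2 * (u\<^sub>j)\<^sub>x\<^sub>x\<close> with \<open>u = u0\<close> at \<open>t = 0\<close>.
  The formula is meaningful for \<open>\<nu> > 0\<close> and \<open>t > 0\<close> only.
\<close>

definition viscous_solution ::
    "real \<Rightarrow> real ^ 'n \<Rightarrow> (real \<Rightarrow> real ^ 'n) \<Rightarrow> real \<Rightarrow> real \<Rightarrow> real ^ 'n" where
  "viscous_solution \<nu> c u0 x t =
     (\<chi> j. (LINT y|lebesgue. u0 y $ j * hopf_cole_weight \<nu> c u0 x t y) /
           (LINT y|lebesgue. hopf_cole_weight \<nu> c u0 x t y))"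

text \<open>
  Here \<open>Iplus\<close>, \<open>Iminus\<close> stand for the limits of the primitive, and \<open>up\<close>, \<open>um\<close> for those of
  the initial data, at plus and minus infinity.
\<close>

definition asymptotic_profile ::
    "real \<Rightarrow> real \<Rightarrow> real \<Rightarrow> real ^ 'n \<Rightarrow> real ^ 'n \<Rightarrow> real \<Rightarrow> real \<Rightarrow> real ^ 'n" where
  "asymptotic_profile \<nu> Iplus Iminus up um x t =
     (\<chi> j. (up $ j * exp (- Iplus / \<nu>) * (LBINT y:{..x / sqrt (t * \<nu>)}. exp (- y\<^sup>2 / 2)) +
            um $ j * exp (- Iminus / \<nu>) * (LBINT y:{x / sqrt (t * \<nu>)..}. exp (- y\<^sup>2 / 2))) /
           (exp (- Iplus / \<nu>) * (LBINT y:{..x / sqrt (t * \<nu>)}. exp (- y\<^sup>2 / 2)) +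
            exp (- Iminus / \<nu>) * (LBINT y:{x / sqrt (t * \<nu>)..}. exp (- y\<^sup>2 / 2))))"

end

theory Submission imports Defs "HOL-Probability.Distributions" begin

text \<open>
  Put \<open>s = sqrt (t * \<nu>)\<close>. The weight in the Hopf--Cole formula is the product of
  \<open>w y = exp (- sigma_primitive c u0 y / \<nu>)\<close> and the Gaussian
  \<open>exp (- (x - y)\<^sup>2 / (2 * s\<^sup>2))\<close>, so the numerator and the denominator of the solution are
  Gaussian averages, of width \<open>s\<close> around \<open>x\<close>, of \<open>u0 y $ j * w y\<close> and of \<open>w y\<close>. Both
  functions are locally integrable and have limits at plus and minus infinity.

  A wide average sees only these limits. If \<open>f\<close> is locally integrable with limits \<open>A\<close> at plus
  and \<open>B\<close> at minus infinity, let \<open>S\<close> be the step function equal to \<open>A\<close> on the right half-line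
  and to \<open>B\<close> on the left one. The integral of \<open>S\<close> against the Gaussian around \<open>x = s * \<xi>\<close>
  is \<open>s\<close> times \<open>A * \<Phi>(\<xi>) + B * \<Psi>(\<xi>)\<close>, where \<open>\<Phi>\<close> and \<open>\<Psi>\<close> are the lower and the upper
  tail integrals of \<open>exp (- z\<^sup>2 / 2)\<close>. The difference \<open>f - S\<close> is small outside some \<open>{-R..R}\<close>, which
  contributes a small multiple of \<open>s\<close>; on \<open>{-R..R}\<close> it is integrable and the Gaussian is at most
  \<open>1\<close>, which contributes a constant. After division by \<open>s\<close> both errors are small, whatever the
  centre is. Hence the averages converge uniformly in \<open>\<xi>\<close>
  (\<open>heat_kernel_average_limit\<close>).

  In the variable \<open>\<xi> = x / s\<close> the limits do not depend on time, the limit of the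
  denominator is bounded below by a positive constant and that of the numerator is bounded
  (\<open>two_sided_profile_bounds\<close>), so the quotients converge uniformly too. Since \<open>x\<close> and
  \<open>\<xi>\<close> both range over all reals, this is uniform convergence in \<open>x\<close>.
\<close>

section \<open>Gaussian averages of functions with limits at both infinities\<close>

text \<open>
  The factor that would turn the kernel into a probability density is omitted, which gives the
  kernel the bound \<open>1\<close> for every width \<open>s\<close>; it cancels in the quotient anyway.
\<close>

definition heat_kernel :: "real \<Rightarrow> real \<Rightarrow> real \<Rightarrow> real" where
  "heat_kernel s x y = exp (- (x - y)\<^sup>2 / (2 * s\<^sup>2))"

lemma heat_kernel_pos: "0 < heat_kernel s x y"
  by (simp add: heat_kernel_def)

lemma heat_kernel_le_1: "heat_kernel s x y \<le> 1"
  by (simp add: heat_kernel_def)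

lemma borel_measurable_heat_kernel [measurable]: "heat_kernel s x \<in> borel_measurable borel"
  unfolding heat_kernel_def by measurable

lemma heat_kernel_rescale:
  assumes "s > 0"
  shows "heat_kernel s (s * \<xi>) (s * \<xi> + (- s) * z) = exp (- z\<^sup>2 / 2)"
  using assms by (simp add: heat_kernel_def power_mult_distrib)

lemma gaussian_has_integral:
  "has_bochner_integral lborel (\<lambda>y::real. exp (- y\<^sup>2 / 2)) (sqrt (2 * pi))"
proof -
  have "has_bochner_integral lborel (\<lambda>y::real. sqrt (2 * pi) * std_normal_density y) (sqrt (2 * pi) * 1)"
    by (rule has_bochner_integral_mult_right) (use std_normal_moment_even[of 0] in simp)
  then show ?thesis
    by (simp add: std_normal_density_def)
qed

lemma heat_kernel_integral:
  assumes "s > 0"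
  shows "has_bochner_integral lebesgue (heat_kernel s x) (s * sqrt (2 * pi))"
proof -
  have eq: "heat_kernel s x (x + (- s) * z) = exp (- z\<^sup>2 / 2)" for z
    using heat_kernel_rescale[OF assms, of "x / s" z] assms by simp
  have "has_bochner_integral lborel (\<lambda>z. heat_kernel s x (x + (- s) * z)) (sqrt (2 * pi))"
    unfolding eq by (rule gaussian_has_integral)
  then have "has_bochner_integral lborel (heat_kernel s x) (s * sqrt (2 * pi))"
    by (subst lborel_has_bochner_integral_real_affine_iff[of "- s" _ _ x]) (use assms in \<open>simp_all add: field_simps\<close>)
  then show ?thesis
    by (auto simp: has_bochner_integral_iff integrable_completion integral_completion)
qed

lemma locally_integrable_imp_measurable:
  fixes f :: "real \<Rightarrow> real"
  assumes "\<And>a b. f absolutely_integrable_on {a..b}"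
  shows "f \<in> borel_measurable lebesgue"
proof (rule borel_measurable_LIMSEQ_real)
  fix n :: nat
  show "(\<lambda>y. indicator {- real n..real n} y * f y) \<in> borel_measurable lebesgue"
    using assms[of "- real n" "real n"] unfolding set_integrable_def
    by (auto dest: borel_measurable_integrable)
next
  fix y :: real
  obtain m :: nat where m: "\<bar>y\<bar> \<le> real m"
    using real_arch_simple by blast
  have "\<forall>\<^sub>F n in sequentially. indicator {- real n..real n} y * f y = f y"
    using eventually_ge_at_top[of m]
  proof eventually_elim
    case (elim n)
    then have "\<bar>y\<bar> \<le> real n" using m by linarith
    then show ?case by (simp add: abs_le_iff)
  qed
  then show "(\<lambda>n. indicator {- real n..real n} y * f y) \<longlonglongrightarrow> f y"
    by (rule tendsto_eventually)
qed

text \<open>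
  The kernel is at most \<open>1\<close> where \<open>f\<close> may be large, and \<open>\<bar>f\<bar>\<close> is at most \<open>C\<close> elsewhere. The first
  contribution involves neither \<open>s\<close> nor \<open>x\<close>, and neither contribution involves \<open>x\<close>: this is
  where the uniformity in space comes from.
\<close>

lemma locally_integrable_mult_heat_kernel:
  fixes f :: "real \<Rightarrow> real"
  assumes loc: "\<And>a b. f absolutely_integrable_on {a..b}"
    and bnd: "\<And>y. R \<le> \<bar>y\<bar> \<Longrightarrow> \<bar>f y\<bar> \<le> C"
    and "s > 0"
  shows "integrable lebesgue (\<lambda>y. f y * heat_kernel s x y)"
    and "\<bar>LINT y|lebesgue. f y * heat_kernel s x y\<bar>
           \<le> (LINT y:{-R..R}|lebesgue. \<bar>f y\<bar>) + \<bar>C\<bar> * (s * sqrt (2 * pi))"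
proof -
  let ?g = "\<lambda>y. indicator {-R..R} y *\<^sub>R \<bar>f y\<bar> + \<bar>C\<bar> * heat_kernel s x y"
  have i1: "integrable lebesgue (\<lambda>y. indicator {-R..R} y *\<^sub>R \<bar>f y\<bar>)"
    using set_integrable_abs[OF loc[of "-R" R]] by (simp add: set_integrable_def)
  have i2: "integrable lebesgue (heat_kernel s x)"
    and v2: "(LINT y|lebesgue. heat_kernel s x y) = s * sqrt (2 * pi)"
    using heat_kernel_integral[OF \<open>s > 0\<close>, of x] by (auto simp: has_bochner_integral_iff)
  have i: "integrable lebesgue ?g"
    using i1 i2 by auto
  have le: "\<bar>f y * heat_kernel s x y\<bar> \<le> ?g y" for y
  proof (cases "\<bar>y\<bar> \<le> R")
    case True
    have "\<bar>f y\<bar> * heat_kernel s x y \<le> \<bar>f y\<bar>"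
      using heat_kernel_le_1 by (simp add: mult_left_le)
    moreover have "0 \<le> \<bar>C\<bar> * heat_kernel s x y"
      using heat_kernel_pos[of s x y] by simp
    ultimately have "\<bar>f y\<bar> * heat_kernel s x y \<le> \<bar>f y\<bar> + \<bar>C\<bar> * heat_kernel s x y"
      by linarith
    then show ?thesis
      using True heat_kernel_pos[of s x y] by (simp add: abs_mult abs_le_iff)
  next
    case False
    then have "\<bar>f y\<bar> \<le> \<bar>C\<bar>" using bnd[of y] by linarith
    then show ?thesis
      using heat_kernel_pos[of s x y] by (simp add: abs_mult add_increasing)
  qed
  have m: "(\<lambda>y. f y * heat_kernel s x y) \<in> borel_measurable lebesgue"
    using locally_integrable_imp_measurable[OF loc] i2 by (auto dest: borel_measurable_integrable)
  show int: "integrable lebesgue (\<lambda>y. f y * heat_kernel s x y)"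
    by (rule Bochner_Integration.integrable_bound[OF i m]) (use le in \<open>auto intro: order_trans[OF _ abs_ge_self]\<close>)
  have "\<bar>LINT y|lebesgue. f y * heat_kernel s x y\<bar> \<le> (LINT y|lebesgue. ?g y)"
    using Bochner_Integration.integral_norm_bound_integral[OF int i] le by simp
  also have "\<dots> = (LINT y:{-R..R}|lebesgue. \<bar>f y\<bar>) + \<bar>C\<bar> * (s * sqrt (2 * pi))"
    using i1 i2 v2 by (simp add: set_lebesgue_integral_def)
  finally show "\<bar>LINT y|lebesgue. f y * heat_kernel s x y\<bar>
           \<le> (LINT y:{-R..R}|lebesgue. \<bar>f y\<bar>) + \<bar>C\<bar> * (s * sqrt (2 * pi))" .
qed

text \<open>
  Up to the constant factor \<open>1 / sqrt (2 * pi)\<close>, the solution at time \<open>1\<close> of the heat equation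
  with diffusivity \<open>1 / 2\<close> whose initial value jumps from \<open>B\<close> to \<open>A\<close> at the origin.
\<close>

definition two_sided_profile :: "real \<Rightarrow> real \<Rightarrow> real \<Rightarrow> real" where
  "two_sided_profile A B \<xi> =
     A * (LBINT z:{..\<xi>}. exp (- z\<^sup>2 / 2)) + B * (LBINT z:{\<xi>..}. exp (- z\<^sup>2 / 2))"

lemma gaussian_set_integrable:
  "S \<in> sets borel \<Longrightarrow> set_integrable lborel S (\<lambda>z::real. exp (- z\<^sup>2 / 2))"
  unfolding set_integrable_def
  by (rule integrable_mult_indicator) (use gaussian_has_integral in \<open>auto simp: has_bochner_integral_iff\<close>)

lemma gaussian_tails_sum:
  "(LBINT z:{..\<xi>}. exp (- z\<^sup>2 / 2)) + (LBINT z:{\<xi>..}. exp (- z\<^sup>2 / 2)) = sqrt (2 * pi)"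
  (is "?L + ?R = _")
proof -
  have "?R = (LBINT z:{\<xi><..}. exp (- z\<^sup>2 / 2))"
  proof (rule set_integral_null_delta)
    show "integrable lborel (\<lambda>z::real. exp (- z\<^sup>2 / 2))"
      using gaussian_has_integral by (auto simp: has_bochner_integral_iff)
    have "{\<xi>..} - {\<xi><..} \<union> ({\<xi><..} - {\<xi>..}) = {\<xi>}" by auto
    then show "{\<xi>..} - {\<xi><..} \<union> ({\<xi><..} - {\<xi>..}) \<in> null_sets lborel"
      by (simp add: finite_imp_null_set_lborel)
  qed auto
  moreover have "?L + (LBINT z:{\<xi><..}. exp (- z\<^sup>2 / 2)) = (LBINT z:{..\<xi>} \<union> {\<xi><..}. exp (- z\<^sup>2 / 2))"
    by (rule set_integral_Un[symmetric, OF _ gaussian_set_integrable gaussian_set_integrable]) auto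
  moreover have "{..\<xi>} \<union> {\<xi><..} = UNIV" by auto
  moreover have "(LBINT z:UNIV. exp (- z\<^sup>2 / 2)) = sqrt (2 * pi)"
    using gaussian_has_integral by (auto simp: set_lebesgue_integral_def has_bochner_integral_iff)
  ultimately show ?thesis by simp
qed

lemma gaussian_tail_nonneg: "0 \<le> (LBINT z:S. exp (- (z::real)\<^sup>2 / 2))"
  by (simp add: set_lebesgue_integral_def integral_nonneg_AE)

text \<open>
  Substituting \<open>y = s * \<xi> - s * z\<close> turns the kernel into \<open>exp (- z\<^sup>2 / 2)\<close> and the half-line
  \<open>0 \<le> y\<close> into \<open>z \<le> \<xi>\<close>. The two tails overlap in the point \<open>\<xi>\<close>, a null set.
\<close>

lemma heat_kernel_integral_step:
  assumes "s > 0"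
  shows "(LINT y|lebesgue. (if 0 \<le> y then A else B) * heat_kernel s (s * \<xi>) y)
           = s * two_sided_profile A B \<xi>"
proof -
  let ?S = "\<lambda>y::real. if 0 \<le> y then A else B"
  have "(LINT y|lebesgue. ?S y * heat_kernel s (s * \<xi>) y) = (LBINT y. ?S y * heat_kernel s (s * \<xi>) y)"
    by (rule integral_completion) measurable
  also have "\<dots> = s * (LBINT z. ?S (s * \<xi> + (- s) * z) * heat_kernel s (s * \<xi>) (s * \<xi> + (- s) * z))"
    using lborel_integral_real_affine[of "- s" "\<lambda>y. ?S y * heat_kernel s (s * \<xi>) y" "s * \<xi>"] assms
    by simp
  also have "\<dots> = s * (LBINT z. (if z \<le> \<xi> then A else B) * exp (- z\<^sup>2 / 2))"
    unfolding heat_kernel_rescale[OF assms] using assms by simp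
  also have "(LBINT z. (if z \<le> \<xi> then A else B) * exp (- z\<^sup>2 / 2)) =
      (LBINT z. A * (indicator {..\<xi>} z *\<^sub>R exp (- z\<^sup>2 / 2)) + B * (indicator {\<xi>..} z *\<^sub>R exp (- z\<^sup>2 / 2)))"
  proof (rule integral_cong_AE)
    show "AE z in lborel. (if z \<le> \<xi> then A else B) * exp (- z\<^sup>2 / 2) =
        A * (indicator {..\<xi>} z *\<^sub>R exp (- z\<^sup>2 / 2)) + B * (indicator {\<xi>..} z *\<^sub>R exp (- z\<^sup>2 / 2))"
      using AE_lborel_singleton[of \<xi>] by eventually_elim (auto simp: indicator_def)
  qed measurable
  also have "\<dots> = two_sided_profile A B \<xi>"
    using gaussian_set_integrable[of "{..\<xi>}"] gaussian_set_integrable[of "{\<xi>..}"]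
    by (simp add: two_sided_profile_def set_lebesgue_integral_def set_integrable_def)
  finally show ?thesis .
qed

text \<open>
  Subtracting the step function with the same limits reduces the claim to a function that vanishes
  at both infinities, for which the estimate above bounds the error by \<open>M / s\<close> plus
  an arbitrarily small constant.
\<close>

lemma heat_kernel_average_limit:
  fixes f :: "real \<Rightarrow> real"
  assumes loc: "\<And>a b. f absolutely_integrable_on {a..b}"
    and top: "(f \<longlongrightarrow> A) at_top" and bot: "(f \<longlongrightarrow> B) at_bot"
  shows "uniform_limit UNIV (\<lambda>s \<xi>. (LINT y|lebesgue. f y * heat_kernel s (s * \<xi>) y) / s)
           (two_sided_profile A B) at_top"
proof (rule uniform_limitI)
  fix e :: real assume "e > 0"
  let ?S = "\<lambda>y::real. if 0 \<le> y then A else B"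
  \<comment> \<open>The kernel has total mass \<open>s * sqrt (2 * pi)\<close>, so values of modulus at most \<open>d\<close> contribute at most
      \<open>e / 2\<close> after division by \<open>s\<close>.\<close>
  define d where "d = e / (2 * sqrt (2 * pi))"
  have d: "d > 0" "d * sqrt (2 * pi) = e / 2" using \<open>e > 0\<close> by (simp_all add: d_def)
  obtain R1 where R1: "\<And>y. R1 \<le> y \<Longrightarrow> \<bar>f y - A\<bar> < d"
    using tendstoD[OF top d(1)] by (auto simp: eventually_at_top_linorder dist_real_def)
  obtain R2 where R2: "\<And>y. y \<le> R2 \<Longrightarrow> \<bar>f y - B\<bar> < d"
    using tendstoD[OF bot d(1)] by (auto simp: eventually_at_bot_linorder dist_real_def)
  \<comment> \<open>The lower bound \<open>1\<close> keeps \<open>y\<close> away from the jump, so its sign decides which limit applies.\<close>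
  define R where "R = Max {1, R1, - R2}"
  have R: "1 \<le> R" "R1 \<le> R" "- R2 \<le> R" by (auto simp: R_def)
  have far: "\<bar>f y - ?S y\<bar> \<le> d" if "R \<le> \<bar>y\<bar>" for y
    using R1[of y] R2[of y] that R by (auto simp: less_imp_le)
  have stepm: "?S \<in> borel_measurable borel" by measurable
  have step: "?S absolutely_integrable_on {a..b}" for a b
  proof -
    have "set_integrable lborel {a..b} ?S"
      unfolding set_integrable_def
      by (rule integrableI_bounded_set_indicator[where B = "\<bar>A\<bar> + \<bar>B\<bar>"]) (auto simp: emeasure_lborel_Icc_eq)
    then show ?thesis
      by (simp add: set_integrable_def integrable_completion)
  qed
  have diff: "(\<lambda>y. f y - ?S y) absolutely_integrable_on {a..b}" for a b
    by (rule set_integral_diff(1)[OF loc step])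
  define M where "M = (LINT y:{-R..R}|lebesgue. \<bar>f y - ?S y\<bar>)"
  have bound: "\<bar>(LINT y|lebesgue. f y * heat_kernel s (s * \<xi>) y) / s - two_sided_profile A B \<xi>\<bar>
      \<le> M / s + e / 2" if "s > 0" for s \<xi>
  proof -
    have idiff: "integrable lebesgue (\<lambda>y. (f y - ?S y) * heat_kernel s (s * \<xi>) y)"
      by (rule locally_integrable_mult_heat_kernel(1)[OF diff far \<open>s > 0\<close>])
    have istep: "integrable lebesgue (\<lambda>y. ?S y * heat_kernel s (s * \<xi>) y)"
      by (rule locally_integrable_mult_heat_kernel(1)[OF step _ \<open>s > 0\<close>, of 0 "\<bar>A\<bar> + \<bar>B\<bar>"]) auto
    have "(LINT y|lebesgue. f y * heat_kernel s (s * \<xi>) y) =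
        (LINT y|lebesgue. (f y - ?S y) * heat_kernel s (s * \<xi>) y + ?S y * heat_kernel s (s * \<xi>) y)"
      by (simp add: left_diff_distrib)
    also have "\<dots> = (LINT y|lebesgue. (f y - ?S y) * heat_kernel s (s * \<xi>) y) + s * two_sided_profile A B \<xi>"
      unfolding Bochner_Integration.integral_add[OF idiff istep] heat_kernel_integral_step[OF \<open>s > 0\<close>] ..
    finally have "(LINT y|lebesgue. f y * heat_kernel s (s * \<xi>) y) / s - two_sided_profile A B \<xi> =
        (LINT y|lebesgue. (f y - ?S y) * heat_kernel s (s * \<xi>) y) / s"
      using \<open>s > 0\<close> by (simp add: field_simps)
    moreover have "\<bar>LINT y|lebesgue. (f y - ?S y) * heat_kernel s (s * \<xi>) y\<bar> \<le> M + s * (e / 2)"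
      using locally_integrable_mult_heat_kernel(2)[OF diff far \<open>s > 0\<close>, where x = "s * \<xi>"] d
      by (simp add: M_def mult.left_commute[of d s])
    ultimately show ?thesis
      using \<open>s > 0\<close> by (simp add: field_simps)
  qed
  have "((\<lambda>s. M / s) \<longlongrightarrow> 0) at_top"
    by (rule tendsto_divide_0[OF tendsto_const]) (simp add: filterlim_at_top_imp_at_infinity filterlim_ident)
  then have "\<forall>\<^sub>F s in at_top. M / s < e / 2"
    by (rule order_tendstoD) (use \<open>e > 0\<close> in simp)
  then show "\<forall>\<^sub>F s in at_top. \<forall>\<xi>\<in>UNIV.
      dist ((LINT y|lebesgue. f y * heat_kernel s (s * \<xi>) y) / s) (two_sided_profile A B \<xi>) < e"
    using eventually_gt_at_top[of 0]
  proof eventually_elim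
    case (elim s)
    show ?case
    proof
      fix \<xi>
      show "dist ((LINT y|lebesgue. f y * heat_kernel s (s * \<xi>) y) / s) (two_sided_profile A B \<xi>) < e"
        using bound[OF elim(2), of \<xi>] elim(1) unfolding dist_real_def by linarith
    qed
  qed
qed

section \<open>Bounds for the profile\<close>

text \<open>
  The tails are nonnegative and add up to \<open>sqrt (2 * pi)\<close>, so the profile is \<open>sqrt (2 * pi)\<close>
  times a convex combination of \<open>A\<close> and \<open>B\<close>.
\<close>

lemma two_sided_profile_bounds:
  shows "min A B * sqrt (2 * pi) \<le> two_sided_profile A B \<xi>"
    and "\<bar>two_sided_profile A B \<xi>\<bar> \<le> max \<bar>A\<bar> \<bar>B\<bar> * sqrt (2 * pi)"
proof -
  define p where "p = (LBINT z:{..\<xi>}. exp (- z\<^sup>2 / 2))"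
  define q where "q = (LBINT z:{\<xi>..}. exp (- z\<^sup>2 / 2))"
  have pq: "0 \<le> p" "0 \<le> q" "sqrt (2 * pi) = p + q"
    unfolding p_def q_def using gaussian_tail_nonneg gaussian_tails_sum[of \<xi>] by auto
  have eq: "two_sided_profile A B \<xi> = A * p + B * q"
    by (simp add: two_sided_profile_def p_def q_def)
  have "min A B * p \<le> A * p" "min A B * q \<le> B * q"
    using pq by (auto intro: mult_right_mono)
  then show "min A B * sqrt (2 * pi) \<le> two_sided_profile A B \<xi>"
    unfolding eq pq(3) by (simp add: distrib_left)
  have "\<bar>A * p\<bar> \<le> max \<bar>A\<bar> \<bar>B\<bar> * p" "\<bar>B * q\<bar> \<le> max \<bar>A\<bar> \<bar>B\<bar> * q"
    using pq by (auto simp: abs_mult intro: mult_right_mono)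
  then show "\<bar>two_sided_profile A B \<xi>\<bar> \<le> max \<bar>A\<bar> \<bar>B\<bar> * sqrt (2 * pi)"
    unfolding eq pq(3) distrib_left by linarith
qed

section \<open>The primitive of the velocity\<close>

lemma sigma_absolutely_integrable:
  assumes "\<And>j. (\<lambda>z. u0 z $ j) absolutely_integrable_on S"
  shows "(\<lambda>z. sigma c (u0 z)) absolutely_integrable_on S"
  unfolding sigma_def by (intro absolutely_integrable_sum set_integrable_mult_right) (use assms in auto)

text \<open>
  A base point \<open>m\<close> to the left of \<open>0\<close> and of \<open>x\<close> removes the case distinction in the oriented
  integral, so that continuity across \<open>0\<close> follows from that of an indefinite integral.
\<close>

lemma sigma_primitive_eq_integral:
  assumes "\<And>j a b. (\<lambda>z. u0 z $ j) absolutely_integrable_on {a..b}"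
    and "m \<le> 0" "m \<le> x"
  shows "sigma_primitive c u0 x =
    integral {m..x} (\<lambda>z. sigma c (u0 z)) - integral {m..0} (\<lambda>z. sigma c (u0 z))"
proof -
  let ?f = "\<lambda>z. sigma c (u0 z)"
  have abs: "?f absolutely_integrable_on {a..b}" for a b
    by (rule sigma_absolutely_integrable) (rule assms)
  have int: "?f integrable_on {a..b}" for a b
    using abs by (rule set_lebesgue_integral_eq_integral(1))
  have open_int: "(LINT z:{a<..<b}|lebesgue. ?f z) = integral {a..b} ?f" for a b
  proof -
    have "set_integrable lebesgue {a<..<b} ?f"
      by (rule set_integrable_subset[OF abs[of a b]]) auto
    then show ?thesis
      by (simp add: set_lebesgue_integral_eq_integral(2) integral_open_interval_real)
  qed
  show ?thesis
  proof (cases "0 \<le> x")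
    case True
    have "sigma_primitive c u0 x = integral {0..x} ?f"
      using True open_int[of 0 x]
      by (simp add: sigma_primitive_def interval_lebesgue_integral_def zero_ereal_def)
    then show ?thesis
      using Henstock_Kurzweil_Integration.integral_combine[OF \<open>m \<le> 0\<close> True int] by simp
  next
    case False
    have "sigma_primitive c u0 x = - integral {x..0} ?f"
      using False open_int[of x 0]
      by (simp add: sigma_primitive_def interval_lebesgue_integral_def zero_ereal_def)
    then show ?thesis
      using Henstock_Kurzweil_Integration.integral_combine[OF \<open>m \<le> x\<close> _ int, of 0] False by simp
  qed
qed

lemma continuous_sigma_primitive:
  assumes "\<And>j a b. (\<lambda>z. u0 z $ j) absolutely_integrable_on {a..b}"
  shows "continuous_on {a..b} (sigma_primitive c u0)"
proof -
  define m where "m = min a 0"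
  have "(\<lambda>z. sigma c (u0 z)) integrable_on {m..b}"
    by (rule set_lebesgue_integral_eq_integral(1), rule sigma_absolutely_integrable, rule assms)
  then have "continuous_on {m..b}
      (\<lambda>x. integral {m..x} (\<lambda>z. sigma c (u0 z)) - integral {m..0} (\<lambda>z. sigma c (u0 z)))"
    by (intro continuous_intros indefinite_integral_continuous_1)
  then have "continuous_on {a..b}
      (\<lambda>x. integral {m..x} (\<lambda>z. sigma c (u0 z)) - integral {m..0} (\<lambda>z. sigma c (u0 z)))"
    by (rule continuous_on_subset) (auto simp: m_def)
  then show ?thesis
    by (rule continuous_on_eq) (subst sigma_primitive_eq_integral[OF assms, of m], auto simp: m_def)
qed

section \<open>The viscous solution for large time\<close>

lemma hopf_cole_weight_eq:
  assumes "\<nu> > 0" "t > 0"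
  shows "hopf_cole_weight \<nu> c u0 x t y =
    exp (- sigma_primitive c u0 y / \<nu>) * heat_kernel (sqrt (t * \<nu>)) x y"
  using assms
  by (simp add: hopf_cole_weight_def heat_kernel_def exp_add[symmetric] field_simps)

theorem theorem2p1:
  fixes c :: "real ^ 'n" and u0 :: "real \<Rightarrow> real ^ 'n" and \<nu> :: real
    and Iplus Iminus :: real and up um :: "real ^ 'n"
  assumes "\<nu> > 0"
    and "\<And>j a b. (\<lambda>z. u0 z $ j) absolutely_integrable_on {a..b}"
    and "(sigma_primitive c u0 \<longlongrightarrow> Iplus) at_top"
    and "(sigma_primitive c u0 \<longlongrightarrow> Iminus) at_bot"
    and "\<And>j. ((\<lambda>x. u0 x $ j) \<longlongrightarrow> up $ j) at_top"
    and "\<And>j. ((\<lambda>x. u0 x $ j) \<longlongrightarrow> um $ j) at_bot"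
  shows "\<forall>j. uniform_limit UNIV
           (\<lambda>t x. viscous_solution \<nu> c u0 x t $ j - asymptotic_profile \<nu> Iplus Iminus up um x t $ j)
           (\<lambda>x. 0) at_top"
proof
  fix j :: 'n
  define w where "w y = exp (- sigma_primitive c u0 y / \<nu>)" for y
  define Ep where "Ep = exp (- Iplus / \<nu>)"
  define Em where "Em = exp (- Iminus / \<nu>)"
  have wcont: "continuous_on {a..b} w" for a b
    unfolding w_def using assms(1) by (intro continuous_intros continuous_sigma_primitive[OF assms(2)]) auto
  have wloc: "w absolutely_integrable_on {a..b}" for a b
    by (rule absolutely_integrable_continuous_real[OF wcont])
  \<comment> \<open>The initial data may be unbounded on compact intervals, but \<open>w\<close> is continuous, hence bounded there.\<close>
  have uwloc: "(\<lambda>y. u0 y $ j * w y) absolutely_integrable_on {a..b}" for a b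
  proof -
    have "w \<in> borel_measurable (lebesgue_on {a..b})"
      by (rule continuous_imp_measurable_on_sets_lebesgue[OF wcont]) simp
    moreover have "bounded (w ` {a..b})"
      by (intro compact_imp_bounded compact_continuous_image[OF wcont]) simp
    ultimately have "(\<lambda>y. w y * u0 y $ j) absolutely_integrable_on {a..b}"
      using assms(2) by (intro absolutely_integrable_bounded_measurable_product_real) auto
    then show ?thesis by (simp add: mult.commute)
  qed
  have wlim: "(w \<longlongrightarrow> Ep) at_top" "(w \<longlongrightarrow> Em) at_bot"
    unfolding w_def Ep_def Em_def using assms(1) by (auto intro!: tendsto_intros assms(3,4))
  define N where "N s \<xi> = (LINT y|lebesgue. (u0 y $ j * w y) * heat_kernel s (s * \<xi>) y) / s" for s \<xi>
  define D where "D s \<xi> = (LINT y|lebesgue. w y * heat_kernel s (s * \<xi>) y) / s" for s \<xi>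
  define P where "P = two_sided_profile (up $ j * Ep) (um $ j * Em)"
  define Q where "Q = two_sided_profile Ep Em"
  have N: "uniform_limit UNIV N P at_top"
    unfolding N_def P_def
    by (intro heat_kernel_average_limit uwloc tendsto_mult wlim assms(5,6))
  have D: "uniform_limit UNIV D Q at_top"
    unfolding D_def Q_def by (intro heat_kernel_average_limit wloc wlim)
  \<comment> \<open>In the similarity variable the limits \<open>P\<close> and \<open>Q\<close> no longer depend on time, so the quotient
      rule for uniform limits applies.\<close>
  have quot: "uniform_limit UNIV (\<lambda>s \<xi>. N s \<xi> / D s \<xi>) (\<lambda>\<xi>. P \<xi> / Q \<xi>) at_top"
  proof (rule uniform_lim_divide[OF N D])
    show "bounded (range P)"
      unfolding bounded_iff P_def using two_sided_profile_bounds(2) by auto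
    show "min Ep Em * sqrt (2 * pi) \<le> norm (Q \<xi>)" for \<xi>
      using two_sided_profile_bounds(1)[of Ep Em \<xi>] unfolding Q_def by (simp add: order_trans[OF _ abs_ge_self])
    show "min Ep Em * sqrt (2 * pi) > 0"
      by (simp add: Ep_def Em_def)
  qed
  have scale: "filterlim (\<lambda>t. sqrt (t * \<nu>)) at_top at_top"
    using assms(1)
    by (intro filterlim_compose[OF sqrt_at_top] filterlim_at_top_mult_tendsto_pos[OF tendsto_const] filterlim_ident)
  have sol: "viscous_solution \<nu> c u0 x t $ j = N s (x / s) / D s (x / s)"
    and prof: "asymptotic_profile \<nu> Iplus Iminus up um x t $ j = P (x / s) / Q (x / s)"
    if "t > 0" "s = sqrt (t * \<nu>)" for x t s
  proof -
    have "s > 0" using that assms(1) by simp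
    then show "viscous_solution \<nu> c u0 x t $ j = N s (x / s) / D s (x / s)"
      by (simp add: viscous_solution_def N_def D_def hopf_cole_weight_eq[OF assms(1) that(1)] w_def
          mult.assoc flip: that(2))
    show "asymptotic_profile \<nu> Iplus Iminus up um x t $ j = P (x / s) / Q (x / s)"
      by (simp add: asymptotic_profile_def P_def Q_def two_sided_profile_def Ep_def Em_def that(2))
  qed
  show "uniform_limit UNIV
      (\<lambda>t x. viscous_solution \<nu> c u0 x t $ j - asymptotic_profile \<nu> Iplus Iminus up um x t $ j)
      (\<lambda>x. 0) at_top"
  proof (rule uniform_limitI)
    fix e :: real assume "e > 0"
    have "\<forall>\<^sub>F s in at_top. \<forall>\<xi>\<in>UNIV. dist (N s \<xi> / D s \<xi>) (P \<xi> / Q \<xi>) < e"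
      using uniform_limitD[OF quot \<open>e > 0\<close>] .
    then have "\<forall>\<^sub>F t in at_top. \<forall>\<xi>\<in>UNIV.
        dist (N (sqrt (t * \<nu>)) \<xi> / D (sqrt (t * \<nu>)) \<xi>) (P \<xi> / Q \<xi>) < e"
      by (rule eventually_compose_filterlim[OF _ scale])
    then show "\<forall>\<^sub>F t in at_top. \<forall>x\<in>UNIV.
        dist (viscous_solution \<nu> c u0 x t $ j - asymptotic_profile \<nu> Iplus Iminus up um x t $ j) 0 < e"
      using eventually_gt_at_top[of 0]
    proof eventually_elim
      case (elim t)
      then show ?case
        by (simp add: sol[OF elim(2) refl] prof[OF elim(2) refl] dist_real_def)
    qed
  qed
qed

end
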